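(* Let $(X,d)$ be a separable length space and $\Omega\colon X\to(0,+\infty)$ a continuous function. Then for every $s>0$ the $s$-dimensional Hausdorff measures $\mathcal H^s_d$ and $\mathcal H^s_{d_\Omega}$ (with respect to $d$ and $d_\Omega$, respectively) are mutually absolutely continuous. In particular, one vanishes if and only if the other does. Moreover, one is $\sigma$-finite if and only if the other one is, and in that case, for every Borel set $E\subseteq X$, $$\mathcal H^s_{d_\Omega}(E)=\int_E\Omega(x)^s\,d\mathcal H^s_d(x).$$
   Context: Let $(X,d)$ be a metric space (with finite-valued $d$). Paths are maps $\gamma\colon[a,b]\to X$ continuous with respect to $d$. The variational length is $L^d(\gamma):=\sup\{\sum_{i=0}^{m-1}d(\gamma(t_i),\gamma(t_{i+1})):a=t_0<\dots<t_m=b\}$. $(X,d)$ is a length space if $d(x,y)=\inf\{L^d(\gamma):\gamma\text{ a path from }x\text{ to }y\}$ for all $x,y\in X$. For a continuous $\Omega\colon X\to(0,+\infty)$ the conformal length of a path $\gamma\colon[a,b]\to X$ is $$L_\Omega^d(\gamma):=\sup\Big\{\sum_{i=0}^{m-1}\min_{t\in[t_i,t_{i+1}]}\Omega(\gamma(t))\,d(\gamma(t_i),\gamma(t_{i+1}))\ :\ a=t_0<\dots<t_m=b\Big\},$$ and the conformal length metric is $d_\Omega(x,y):=\inf\{L_\Omega^d(\gamma):\gamma\text{ a path from }x\text{ to }y\}$. The Hausdorff measures $\mathcal H^s_d$, $\mathcal H^s_{d_\Omega}$ are the usual ones on metric spaces, with the same normalization constant, regarded as Borel measures on $X$ (the metrics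 $d$ and $d_\Omega$ induce the same topology on a length space). *)

theory Defs
  imports "HOL-Analysis.Analysis"
begin

text \<open>The metric space \<open>(X, d)\<close> is a type of class \<^class>\<open>metric_space\<close> with
  \<open>d = dist\<close>. Lengths and infima of lengths take values in \<^typ>\<open>ennreal\<close>, so that
  paths of infinite length and infima over no paths (\<open>= \<infinity>\<close>) are treated literally.\<close>

text \<open>Only \<open>t 0, \<dots>, t m\<close> matter. For \<open>a = b\<close> the only partition has \<open>m = 0\<close>.\<close>

definition interval_partitions :: "real \<Rightarrow> real \<Rightarrow> (nat \<times> (nat \<Rightarrow> real)) set" where
  "interval_partitions a b = {(m, t). t 0 = a \<and> t m = b \<and> (\<forall>i<m. t i < t (Suc i))}"

definition paths_between ::
    "'a::topological_space \<Rightarrow> 'a \<Rightarrow> (real \<times> real \<times> (real \<Rightarrow> 'a)) set" where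
  "paths_between x y =
     {(a, b, \<gamma>). a \<le> b \<and> continuous_on {a..b} \<gamma> \<and> \<gamma> a = x \<and> \<gamma> b = y}"

definition variational_length ::
    "real \<Rightarrow> real \<Rightarrow> (real \<Rightarrow> 'a::metric_space) \<Rightarrow> ennreal" where
  "variational_length a b \<gamma> =
     (SUP (m, t) \<in> interval_partitions a b.
        \<Sum>i<m. ennreal (dist (\<gamma> (t i)) (\<gamma> (t (Suc i)))))"

definition length_space :: "'a::metric_space itself \<Rightarrow> bool" where
  "length_space _ \<longleftrightarrow>
     (\<forall>x y :: 'a. ennreal (dist x y) =
        (INF (a, b, \<gamma>) \<in> paths_between x y. variational_length a b \<gamma>))"

text \<open>For continuous \<open>\<Omega>\<close> and \<open>\<gamma>\<close> the infimum over the compact interval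
  \<open>{t i..t (Suc i)}\<close> is attained, i.e. it is the minimum.\<close>

definition conformal_length ::
    "('a::metric_space \<Rightarrow> real) \<Rightarrow> real \<Rightarrow> real \<Rightarrow> (real \<Rightarrow> 'a) \<Rightarrow> ennreal" where
  "conformal_length \<Omega> a b \<gamma> =
     (SUP (m, t) \<in> interval_partitions a b.
        \<Sum>i<m. ennreal ((INF u\<in>{t i..t (Suc i)}. \<Omega> (\<gamma> u)) *
                          dist (\<gamma> (t i)) (\<gamma> (t (Suc i)))))"

definition conformal_dist ::
    "('a::metric_space \<Rightarrow> real) \<Rightarrow> 'a \<Rightarrow> 'a \<Rightarrow> ennreal" where
  "conformal_dist \<Omega> x y =
     (INF (a, b, \<gamma>) \<in> paths_between x y. conformal_length \<Omega> a b \<gamma>)"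

text \<open>Hausdorff measures are defined for an arbitrary distance function \<open>\<rho>\<close>, since two
  different distances on the same type have to be compared.\<close>

definition diam_of :: "('a \<Rightarrow> 'a \<Rightarrow> ennreal) \<Rightarrow> 'a set \<Rightarrow> ennreal" where
  "diam_of \<rho> A = (SUP (x, y) \<in> A \<times> A. \<rho> x y)"

text \<open>The covering sets are arbitrary subsets; empty ones are allowed and contribute \<open>0\<close>
  (\<open>0 powr s = 0\<close>), so finite covers are included. The diameters occurring are at most
  \<open>\<delta>\<close>, hence finite, so nothing is lost by \<^const>\<open>enn2real\<close>. The factor \<open>c\<close> is the
  normalization constant, e.g. \<open>pi powr (s/2) / (2 powr s * Gamma (s/2 + 1))\<close>, or \<open>1\<close>.\<close>

definition hausdorff_content ::
    "('a \<Rightarrow> 'a \<Rightarrow> ennreal) \<Rightarrow> real \<Rightarrow> real \<Rightarrow> real \<Rightarrow> 'a set \<Rightarrow> ennreal" where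
  "hausdorff_content \<rho> c s \<delta> A =
     (INF E \<in> {E :: nat \<Rightarrow> 'a set. A \<subseteq> (\<Union>i. E i) \<and> (\<forall>i. diam_of \<rho> (E i) \<le> ennreal \<delta>)}.
        \<Sum>i. ennreal (c * enn2real (diam_of \<rho> (E i)) powr s))"

definition hausdorff_outer ::
    "('a \<Rightarrow> 'a \<Rightarrow> ennreal) \<Rightarrow> real \<Rightarrow> real \<Rightarrow> 'a set \<Rightarrow> ennreal" where
  "hausdorff_outer \<rho> c s A = (SUP \<delta>\<in>{0<..}. hausdorff_content \<rho> c s \<delta> A)"

text \<open>The restriction of the outer measure to the Borel sets of the ambient type. By
  Caratheodory's criterion it is countably additive there as soon as \<open>\<rho>\<close> is a metric inducing
  the topology of the type, so that \<^const>\<open>measure_of\<close> does not degenerate to the zero measure.\<close>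

definition hausdorff_measure ::
    "('a::topological_space \<Rightarrow> 'a \<Rightarrow> ennreal) \<Rightarrow> real \<Rightarrow> real \<Rightarrow> 'a measure" where
  "hausdorff_measure \<rho> c s = measure_of UNIV (sets borel) (hausdorff_outer \<rho> c s)"

end

theory Submission
  imports Defs
begin

text \<open>
  The conformal distance is, infinitesimally, \<open>dist\<close> multiplied by the value of \<open>\<Omega>\<close>. Precisely,
  if \<open>m \<le> \<Omega> \<le> M\<close> on \<open>ball x (4 * r)\<close>, then on \<open>ball x r\<close> the conformal distance lies
  between \<open>m * dist\<close> and \<open>M * dist\<close> (\<open>conformal_dist_ge_local\<close>, \<open>conformal_dist_le_local\<close>):
  almost shortest paths stay in the large ball, and a path that leaves it is already too long.
  Consequently the two Hausdorff outer measures differ on subsets of the small ball by a factor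
  between \<open>m powr s\<close> and \<open>M powr s\<close> (\<open>hausdorff_outer_conformal_dist_local\<close>). By continuity of
  \<open>\<Omega>\<close>, the ratio of \<open>M powr s\<close> and \<open>m powr s\<close> can be any \<open>K > 1\<close>, and by separability countably
  many such balls cover the space. Summing over a disjoint refinement of the cover, the
  conformal Hausdorff measure \<open>\<nu>\<close> and the measure with density \<open>\<Omega> powr s\<close> with respect to the
  Hausdorff measure \<open>\<mu>\<close> of \<open>dist\<close> agree up to the factor \<open>K\<close> on all Borel sets. Letting
  \<open>K\<close> tend to \<open>1\<close> gives \<open>\<nu> = density \<mu> (\<Omega> powr s)\<close>
  (\<open>hausdorff_measure_conformal_dist_eq_density\<close>). Since \<open>\<Omega>\<close> is positive and finite, \<open>\<mu>\<close> is in turn the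
  measure with density \<open>\<Omega> powr (- s)\<close> with respect to \<open>\<nu>\<close>, and all assertions follow.

  The summation uses that the outer measures are countably additive on Borel sets. For a distance
  function \<open>\<rho>\<close> which is, locally uniformly, bounded below away from the diagonal of \<open>dist\<close>,
  the classical argument of Caratheodory shows this first for small open
  sets and then, by separability, for all of them
  (\<open>borel_subset_lambda_system_hausdorff_outer\<close>). The lower estimate for the conformal distance
  provides exactly this hypothesis.
\<close>

section \<open>Paths and local estimates for the conformal distance\<close>

lemma interval_partition_in_interval:
  assumes "(m, t) \<in> interval_partitions a b" "i \<le> m"
  shows "t i \<in> {a..b}"
proof -
  have t: "t 0 = a" "t m = b" "\<And>i. i < m \<Longrightarrow> t i < t (Suc i)"
    using assms(1) by (auto simp: interval_partitions_def)
  have "a \<le> t i" using assms(2)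
  proof (induction i)
    case (Suc i)
    then show ?case using t(3)[of i] by simp
  qed (simp add: t)
  moreover have "t i \<le> t m" using assms(2)
  proof (induction rule: inc_induct)
    case (step i)
    then show ?case using t(3)[of i] by simp
  qed simp
  ultimately show ?thesis by (simp add: t)
qed

text \<open>The length is the conformal length of weight \<open>1\<close>, so estimates for lengths of
  initial chords have to be proved only once.\<close>

lemma conformal_length_const_1: "conformal_length (\<lambda>_. 1) a b \<gamma> = variational_length a b \<gamma>"
  unfolding conformal_length_def variational_length_def
proof (intro SUP_cong refl, clarify, intro sum.cong refl)
  fix m i :: nat and t :: "nat \<Rightarrow> real" assume "(m, t) \<in> interval_partitions a b" "i \<in> {..<m}"
  then have "t i \<le> t (Suc i)" by (force simp: interval_partitions_def)
  then show "ennreal ((INF u\<in>{t i..t (Suc i)}. 1) * dist (\<gamma> (t i)) (\<gamma> (t (Suc i)))) =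
      ennreal (dist (\<gamma> (t i)) (\<gamma> (t (Suc i))))" by simp
qed

text \<open>The coarsest partition that contains \<open>\<tau>\<close> already gives this lower bound: all its
  other terms are nonnegative.\<close>

lemma conformal_length_ge_chord:
  assumes "a \<le> \<tau>" "\<tau> \<le> b"
  shows "ennreal ((INF u\<in>{a..\<tau>}. \<Omega> (\<gamma> u)) * dist (\<gamma> a) (\<gamma> \<tau>)) \<le> conformal_length \<Omega> a b \<gamma>"
proof -
  consider "\<tau> = a" | "a < \<tau>" "\<tau> = b" | "a < \<tau>" "\<tau> < b" using assms by linarith
  then show ?thesis
  proof cases
    case 1
    then show ?thesis by simp
  next
    case 2
    define t where "t i = (if i = 0 then a else b)" for i :: nat
    have "(1, t) \<in> interval_partitions a b" using 2 by (auto simp: interval_partitions_def t_def)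
    from SUP_upper[OF this, of "\<lambda>(m, t). \<Sum>i<m. ennreal ((INF u\<in>{t i..t (Suc i)}. \<Omega> (\<gamma> u)) *
                          dist (\<gamma> (t i)) (\<gamma> (t (Suc i))))"]
    show ?thesis using 2 by (simp add: conformal_length_def t_def)
  next
    case 3
    define t where "t i = (if i = 0 then a else if i = 1 then \<tau> else b)" for i :: nat
    have "(2, t) \<in> interval_partitions a b"
      using 3 by (auto simp: interval_partitions_def t_def)
    from SUP_upper[OF this, of "\<lambda>(m, t). \<Sum>i<m. ennreal ((INF u\<in>{t i..t (Suc i)}. \<Omega> (\<gamma> u)) *
                          dist (\<gamma> (t i)) (\<gamma> (t (Suc i))))"]
    have "(\<Sum>i<2. ennreal ((INF u\<in>{t i..t (Suc i)}. \<Omega> (\<gamma> u)) *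
                          dist (\<gamma> (t i)) (\<gamma> (t (Suc i))))) \<le> conformal_length \<Omega> a b \<gamma>"
      by (simp add: conformal_length_def)
    then show ?thesis by (simp add: t_def numeral_2_eq_2) (meson add_increasing2 order_trans le_iff_add)
  qed
qed

lemma variational_length_ge_chord:
  assumes "a \<le> \<tau>" "\<tau> \<le> b"
  shows "ennreal (dist (\<gamma> a) (\<gamma> \<tau>)) \<le> variational_length a b \<gamma>"
  using conformal_length_ge_chord[OF assms, of "\<lambda>_. 1" \<gamma>] assms
  by (simp add: conformal_length_const_1)

lemma conformal_length_le:
  assumes "\<And>x. 0 \<le> \<Omega> x" "\<And>u. u \<in> {a..b} \<Longrightarrow> \<Omega> (\<gamma> u) \<le> M"
  shows "conformal_length \<Omega> a b \<gamma> \<le> ennreal M * variational_length a b \<gamma>"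
  unfolding conformal_length_def
proof (intro SUP_least, clarify)
  fix m :: nat and t :: "nat \<Rightarrow> real" assume mt: "(m, t) \<in> interval_partitions a b"
  have "(\<Sum>i<m. ennreal ((INF u\<in>{t i..t (Suc i)}. \<Omega> (\<gamma> u)) * dist (\<gamma> (t i)) (\<gamma> (t (Suc i)))))
      \<le> (\<Sum>i<m. ennreal M * ennreal (dist (\<gamma> (t i)) (\<gamma> (t (Suc i)))))"
  proof (intro sum_mono)
    fix i assume i: "i \<in> {..<m}"
    have ti: "t i \<in> {a..b}" using interval_partition_in_interval[OF mt, of i] i by simp
    have le: "t i \<le> t (Suc i)" using mt i by (force simp: interval_partitions_def)
    have "(INF u\<in>{t i..t (Suc i)}. \<Omega> (\<gamma> u)) \<le> \<Omega> (\<gamma> (t i))"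
      by (rule cINF_lower) (use assms le in \<open>auto intro!: bdd_belowI[of _ 0]\<close>)
    also have "\<dots> \<le> M" using assms ti by blast
    finally have "(INF u\<in>{t i..t (Suc i)}. \<Omega> (\<gamma> u)) * dist (\<gamma> (t i)) (\<gamma> (t (Suc i)))
       \<le> M * dist (\<gamma> (t i)) (\<gamma> (t (Suc i)))" by (intro mult_right_mono) auto
    moreover have "0 \<le> M" using assms(1)[of "\<gamma> (t i)"] assms(2)[OF ti] by linarith
    ultimately show "ennreal ((INF u\<in>{t i..t (Suc i)}. \<Omega> (\<gamma> u)) * dist (\<gamma> (t i)) (\<gamma> (t (Suc i))))
      \<le> ennreal M * ennreal (dist (\<gamma> (t i)) (\<gamma> (t (Suc i))))"
      by (simp add: ennreal_mult[symmetric] ennreal_leI)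
  qed
  also have "\<dots> = ennreal M * (\<Sum>i<m. ennreal (dist (\<gamma> (t i)) (\<gamma> (t (Suc i)))))"
    by (rule sum_distrib_left[symmetric])
  also have "\<dots> \<le> ennreal M * variational_length a b \<gamma>"
    unfolding variational_length_def by (intro mult_left_mono SUP_upper2[OF mt]) auto
  finally show "(\<Sum>i<m. ennreal ((INF u\<in>{t i..t (Suc i)}. \<Omega> (\<gamma> u)) * dist (\<gamma> (t i)) (\<gamma> (t (Suc i)))))
      \<le> ennreal M * variational_length a b \<gamma>" .
qed

text \<open>A path from \<open>y\<close> either stays in \<open>ball x (3 * r)\<close>, where the weight is at least
  \<open>m\<close>, or it has an initial piece in the closed ball which ends on the sphere of radius
  \<open>3 * r\<close> and so has a chord of length at least \<open>2 * r\<close>. The point \<open>z\<close> is arbitrary: the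
  truncated form of the bound also shows that points far from \<open>y\<close> for \<open>dist\<close> are
  uniformly far from \<open>y\<close> for \<^term>\<open>conformal_dist \<Omega>\<close>, which is what makes Borel sets
  measurable for its Hausdorff measure.\<close>

lemma conformal_dist_ge_local:
  assumes \<Omega>: "\<And>w. w \<in> ball x (4 * r) \<Longrightarrow> m \<le> \<Omega> w" and "0 \<le> m" "0 < r" and y: "y \<in> ball x r"
  shows "ennreal (m * min (dist y z) (2 * r)) \<le> conformal_dist \<Omega> y z"
  unfolding conformal_dist_def
proof (intro INF_greatest, clarify)
  fix a b \<gamma> assume "(a, b, \<gamma>) \<in> paths_between y z"
  then have ab: "a \<le> b" and cont: "continuous_on {a..b} \<gamma>" and ends: "\<gamma> a = y" "\<gamma> b = z"
    by (auto simp: paths_between_def)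
  have *: "ennreal (m * min (dist y z) (2 * r)) \<le> conformal_length \<Omega> a b \<gamma>"
    if \<tau>: "\<tau> \<in> {a..b}" and in_ball: "\<And>u. u \<in> {a..\<tau>} \<Longrightarrow> \<gamma> u \<in> ball x (4 * r)"
      and far: "min (dist y z) (2 * r) \<le> dist y (\<gamma> \<tau>)" for \<tau>
  proof -
    have "m \<le> (INF u\<in>{a..\<tau>}. \<Omega> (\<gamma> u))"
      using \<tau> by (intro cINF_greatest \<Omega> in_ball) auto
    then have "m * min (dist y z) (2 * r) \<le> (INF u\<in>{a..\<tau>}. \<Omega> (\<gamma> u)) * dist (\<gamma> a) (\<gamma> \<tau>)"
      using far assms ends by (intro mult_mono) auto
    then show ?thesis
      using conformal_length_ge_chord[of a \<tau> b \<Omega> \<gamma>] \<tau> by (auto intro: ennreal_leI order_trans)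
  qed
  show "ennreal (m * min (dist y z) (2 * r)) \<le> conformal_length \<Omega> a b \<gamma>"
  proof (cases "\<forall>u\<in>{a..b}. dist x (\<gamma> u) < 3 * r")
    case True
    show ?thesis using True ab ends \<open>0 < r\<close> by (intro *[of b]) force+
  next
    case False
    define S where "S = {u\<in>{a..b}. 3 * r \<le> dist x (\<gamma> u)}"
    have contd: "continuous_on {a..b} (\<lambda>u. dist x (\<gamma> u))" using cont by (intro continuous_intros)
    have "closed S" unfolding S_def
      by (rule continuous_on_closed_Collect_le) (use contd in auto)
    moreover have "bounded S" unfolding S_def by (rule bounded_subset[of "{a..b}"]) auto
    ultimately have "compact S" by (simp add: compact_eq_bounded_closed)
    moreover have "S \<noteq> {}" using False by (auto simp: S_def)
    ultimately obtain \<tau> where \<tau>: "\<tau> \<in> S" "\<And>u. u \<in> S \<Longrightarrow> \<tau> \<le> u"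
      using compact_attains_inf by meson
    have before: "dist x (\<gamma> u) < 3 * r" if "u \<in> {a..<\<tau>}" for u
      using \<tau>(2)[of u] \<tau>(1) that by (force simp: S_def)
    have \<tau>ab: "\<tau> \<in> {a..b}" using \<tau>(1) by (simp add: S_def)
    \<comment> \<open>The first exit point lies on the sphere, by the intermediate value theorem.\<close>
    have "dist x (\<gamma> \<tau>) \<le> 3 * r"
    proof (rule ccontr)
      assume *: "\<not> ?thesis"
      have "\<exists>u\<ge>a. u \<le> \<tau> \<and> dist x (\<gamma> u) = 3 * r"
        by (rule IVT') (use * \<tau>ab y ends \<open>0 < r\<close> in \<open>auto intro: continuous_on_subset[OF contd]\<close>)
      then obtain u where "a \<le> u" "u \<le> \<tau>" "dist x (\<gamma> u) = 3 * r" by blast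
      then show False using before[of u] * by (cases "u = \<tau>") auto
    qed
    then have "dist x (\<gamma> u) \<le> 3 * r" if "u \<in> {a..\<tau>}" for u
      using before[of u] that by (cases "u = \<tau>") auto
    moreover have "2 * r \<le> dist y (\<gamma> \<tau>)"
      using \<tau>(1) y dist_triangle[of x "\<gamma> \<tau>" y] by (simp add: S_def)
    ultimately show ?thesis using \<tau>ab \<open>0 < r\<close> by (intro *[of \<tau>]) force+
  qed
qed

text \<open>A path from \<open>y\<close> that is shorter than \<open>2 * r\<close> cannot leave \<open>ball x (4 * r)\<close>, and in a
  length space such paths have lengths arbitrarily close to \<open>dist y z\<close>.\<close>

lemma conformal_dist_le_local:
  fixes x :: "'a::metric_space"
  assumes "length_space TYPE('a)" "\<And>w. 0 \<le> \<Omega> w"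
    and \<Omega>: "\<And>w. w \<in> ball x (4 * r) \<Longrightarrow> \<Omega> w \<le> M" and y: "y \<in> ball x r" and z: "z \<in> ball x r"
  shows "conformal_dist \<Omega> y z \<le> ennreal (M * dist y z)"
proof -
  have r: "0 < r" using y by (metis empty_iff mem_ball not_le order_trans zero_le_dist linorder_not_less)
  have "0 \<le> M" using assms(2)[of x] \<Omega>[of x] r by simp
  have "dist y z < 2 * r" using y z dist_triangle2[of y z x] by (simp add: dist_commute)
  show ?thesis
  proof (rule ennreal_le_epsilon)
    fix e :: real assume "0 < e"
    \<comment> \<open>The summand \<open>1\<close> keeps the denominator positive when \<open>M = 0\<close>.\<close>
    define e' where "e' = e / (M + 1)"
    have e': "0 < e'" "M * e' \<le> e" using \<open>0 < e\<close> \<open>0 \<le> M\<close> by (auto simp: e'_def field_simps)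
    define l where "l = min (2 * r) (dist y z + e')"
    have l: "dist y z < l" "l \<le> 2 * r" "l \<le> dist y z + e'"
      using e' \<open>dist y z < 2 * r\<close> by (auto simp: l_def)
    then have "0 < l" using zero_le_dist[of y z] by linarith
    have "(INF (a, b, \<gamma>) \<in> paths_between y z. variational_length a b \<gamma>) < ennreal l"
    proof -
      have "ennreal (dist y z) < ennreal l" using l \<open>0 < l\<close> by (simp add: ennreal_less_iff)
      then show ?thesis using assms(1) by (simp add: length_space_def)
    qed
    then obtain a b \<gamma> where p: "(a, b, \<gamma>) \<in> paths_between y z" and len: "variational_length a b \<gamma> < ennreal l"
      by (auto simp: INF_less_iff)
    have "\<Omega> (\<gamma> u) \<le> M" if u: "u \<in> {a..b}" for u
    proof (rule \<Omega>)
      have "ennreal (dist y (\<gamma> u)) \<le> variational_length a b \<gamma>"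
        using variational_length_ge_chord[of a u b \<gamma>] u p by (simp add: paths_between_def)
      also note len
      finally have "dist y (\<gamma> u) < 2 * r" using l \<open>0 < l\<close> by (simp add: ennreal_less_iff)
      then show "\<gamma> u \<in> ball x (4 * r)" using y r dist_triangle[of x "\<gamma> u" y] by simp
    qed
    then have "conformal_length \<Omega> a b \<gamma> \<le> ennreal M * variational_length a b \<gamma>"
      by (intro conformal_length_le assms(2))
    also have "\<dots> \<le> ennreal M * ennreal l" using len by (intro mult_left_mono) auto
    also have "\<dots> = ennreal (M * l)" using \<open>0 \<le> M\<close> \<open>0 < l\<close> by (simp add: ennreal_mult)
    also have "\<dots> \<le> ennreal (M * dist y z + e)"
      using mult_left_mono[OF l(3) \<open>0 \<le> M\<close>] e' by (intro ennreal_leI) (simp add: algebra_simps)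
    also have "\<dots> = ennreal (M * dist y z) + ennreal e" using \<open>0 \<le> M\<close> \<open>0 < e\<close> by (simp add: ennreal_plus)
    finally show "conformal_dist \<Omega> y z \<le> ennreal (M * dist y z) + ennreal e"
      unfolding conformal_dist_def by (intro INF_lower2[OF p]) auto
  qed
qed

section \<open>Countable ball covers\<close>

text \<open>The Lindelof property, in the form in which it glues local estimates: around each point
  of a countable dense set, take those balls of radius \<open>1 / (n + 1)\<close> that fit inside some
  given ball.\<close>

lemma countable_ball_cover:
  fixes r :: "'a::metric_space \<Rightarrow> real"
  assumes sep: "separable_space (euclidean :: 'a topology)" and r: "\<And>x. 0 < r x"
  obtains f :: "nat \<Rightarrow> 'a" where "(\<Union>n. ball (f n) (r (f n))) = UNIV"
proof -
  obtain S :: "'a set" where S: "countable S" "closure S = UNIV"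
    using sep by (auto simp: separable_space_def)
  define I where "I = {p \<in> S \<times> (UNIV :: nat set). \<exists>x. ball (fst p) (1 / Suc (snd p)) \<subseteq> ball x (r x)}"
  have "countable I" unfolding I_def using S by (intro countable_Collect countable_SIGMA) auto
  have "\<forall>p\<in>I. \<exists>x. ball (fst p) (1 / Suc (snd p)) \<subseteq> ball x (r x)" by (simp add: I_def)
  then obtain g where g: "\<And>p. p \<in> I \<Longrightarrow> ball (fst p) (1 / Suc (snd p)) \<subseteq> ball (g p) (r (g p))"
    by metis
  have *: "\<exists>p\<in>I. y \<in> ball (g p) (r (g p))" for y
  proof -
    \<comment> \<open>Half the radius, so that the ball around the dense point stays within \<open>ball y (r y)\<close>.\<close>
    obtain n where n: "inverse (real (Suc n)) < r y / 2" using reals_Archimedean[of "r y / 2"] r by auto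
    have "y \<in> closure S" using S by simp
    then obtain s where s: "s \<in> S" "dist s y < 1 / Suc n"
      unfolding closure_approachable by (metis of_nat_0_less_iff zero_less_Suc zero_less_divide_1_iff)
    have "ball s (1 / Suc n) \<subseteq> ball y (r y)"
    proof
      fix w assume "w \<in> ball s (1 / Suc n)"
      then show "w \<in> ball y (r y)"
        using s n dist_triangle[of y w s] by (simp add: dist_commute inverse_eq_divide)
    qed
    then have "(s, n) \<in> I" using s by (auto simp: I_def)
    moreover have "y \<in> ball (g (s, n)) (r (g (s, n)))"
      using g[OF calculation] s by auto
    ultimately show ?thesis by blast
  qed
  have "y \<in> (\<Union>n. ball (g (from_nat_into I n)) (r (g (from_nat_into I n))))" for y
  proof -
    obtain p where p: "p \<in> I" "y \<in> ball (g p) (r (g p))" using *[of y] by (elim bexE)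
    from from_nat_into_surj[OF \<open>countable I\<close> p(1)] obtain n where "from_nat_into I n = p" ..
    then show ?thesis using p(2) by (intro UN_I[of n]) simp_all
  qed
  then show thesis by (intro that[of "\<lambda>n. g (from_nat_into I n)"] UNIV_eq_I[symmetric])
qed

section \<open>Hausdorff outer measures of a distance function\<close>

lemma diam_of_mono: "A \<subseteq> B \<Longrightarrow> diam_of \<rho> A \<le> diam_of \<rho> B"
  unfolding diam_of_def by (intro SUP_subset_mono) auto

lemma diam_of_empty [simp]: "diam_of \<rho> {} = 0"
  by (simp add: diam_of_def bot_ennreal)

lemma diam_of_ge: "x \<in> A \<Longrightarrow> y \<in> A \<Longrightarrow> \<rho> x y \<le> diam_of \<rho> A"
  unfolding diam_of_def by (rule SUP_upper2[of "(x, y)"]) auto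

lemma hausdorff_content_le:
  assumes "A \<subseteq> (\<Union>i. E i)" "\<And>i. diam_of \<rho> (E i) \<le> ennreal \<delta>"
  shows "hausdorff_content \<rho> c s \<delta> A \<le> (\<Sum>i. ennreal (c * enn2real (diam_of \<rho> (E i)) powr s))"
  unfolding hausdorff_content_def using assms by (intro INF_lower) auto

lemma hausdorff_content_ge:
  assumes "\<And>E. A \<subseteq> (\<Union>i. E i) \<Longrightarrow> (\<And>i. diam_of \<rho> (E i) \<le> ennreal \<delta>) \<Longrightarrow>
     K \<le> (\<Sum>i. ennreal (c * enn2real (diam_of \<rho> (E i)) powr s))"
  shows "K \<le> hausdorff_content \<rho> c s \<delta> A"
  unfolding hausdorff_content_def using assms by (intro INF_greatest) auto

lemma hausdorff_content_antimono:
  "\<delta> \<le> \<delta>' \<Longrightarrow> hausdorff_content \<rho> c s \<delta>' A \<le> hausdorff_content \<rho> c s \<delta> A"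
  by (intro hausdorff_content_ge hausdorff_content_le) (simp, metis ennreal_leI order_trans)

lemma hausdorff_content_mono:
  "A \<subseteq> B \<Longrightarrow> hausdorff_content \<rho> c s \<delta> A \<le> hausdorff_content \<rho> c s \<delta> B"
  by (intro hausdorff_content_ge hausdorff_content_le) auto

text \<open>Covers of the sets \<open>A i\<close> that are optimal up to \<open>e / 2 ^ (i + 1)\<close> are merged into
  one sequence by means of a pairing of the natural numbers.\<close>

lemma hausdorff_content_UN_le:
  "hausdorff_content \<rho> c s \<delta> (\<Union>i. A i) \<le> (\<Sum>i. hausdorff_content \<rho> c s \<delta> (A i))"
proof (rule ennreal_le_epsilon)
  fix e :: real
  assume fin: "(\<Sum>i. hausdorff_content \<rho> c s \<delta> (A i)) < top" and e: "0 < e"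
  let ?w = "\<lambda>E. ennreal (c * enn2real (diam_of \<rho> E) powr s)"
  have "\<exists>E. A i \<subseteq> (\<Union>j. E j) \<and> (\<forall>j. diam_of \<rho> (E j) \<le> ennreal \<delta>) \<and>
      (\<Sum>j. ?w (E j)) \<le> hausdorff_content \<rho> c s \<delta> (A i) + ennreal (e * (1/2) ^ Suc i)" for i
  proof -
    have "hausdorff_content \<rho> c s \<delta> (A i) < top"
      using fin by (meson ennreal_suminf_lessD)
    then have "hausdorff_content \<rho> c s \<delta> (A i) < hausdorff_content \<rho> c s \<delta> (A i) + ennreal (e * (1/2) ^ Suc i)"
      using e ennreal_add_left_cancel_less[of "hausdorff_content \<rho> c s \<delta> (A i)" 0 "ennreal (e * (1/2) ^ Suc i)"]
      by (simp add: less_top)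
    then obtain E where "A i \<subseteq> (\<Union>j. E j)" "\<forall>j. diam_of \<rho> (E j) \<le> ennreal \<delta>"
      "(\<Sum>j. ?w (E j)) < hausdorff_content \<rho> c s \<delta> (A i) + ennreal (e * (1/2) ^ Suc i)"
      by (subst (asm) (1) hausdorff_content_def) (auto simp: INF_less_iff)
    then show ?thesis by (intro exI[of _ E]) auto
  qed
  then obtain E where E: "\<And>i. A i \<subseteq> (\<Union>j. E i j)" "\<And>i j. diam_of \<rho> (E i j) \<le> ennreal \<delta>"
    "\<And>i. (\<Sum>j. ?w (E i j)) \<le> hausdorff_content \<rho> c s \<delta> (A i) + ennreal (e * (1/2) ^ Suc i)"
    by metis
  let ?F = "\<lambda>k. case prod_decode k of (i, j) \<Rightarrow> E i j"
  have "hausdorff_content \<rho> c s \<delta> (\<Union>i. A i) \<le> (\<Sum>k. ?w (?F k))"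
  proof (rule hausdorff_content_le)
    show "(\<Union>i. A i) \<subseteq> (\<Union>k. ?F k)"
    proof clarify
      fix x i assume "x \<in> A i"
      then obtain j where "x \<in> E i j" using E(1) by blast
      then show "x \<in> (\<Union>k. ?F k)" by (intro UN_I[of "prod_encode (i, j)"]) auto
    qed
    show "diam_of \<rho> (?F k) \<le> ennreal \<delta>" for k using E(2) by (auto split: prod.split)
  qed
  also have "\<dots> = (\<Sum>k. (\<lambda>(i, j). ?w (E i j)) (prod_decode k))"
    by (intro suminf_cong) (auto split: prod.split)
  also have "\<dots> = (\<Sum>i. \<Sum>j. ?w (E i j))" by (rule suminf_ennreal_2dimen) auto
  also have "\<dots> \<le> (\<Sum>i. hausdorff_content \<rho> c s \<delta> (A i) + ennreal (e * (1/2) ^ Suc i))"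
    using E(3) by (intro suminf_le) auto
  also have "\<dots> = (\<Sum>i. hausdorff_content \<rho> c s \<delta> (A i)) + (\<Sum>i. ennreal (e * (1/2) ^ Suc i))"
    by (simp add: suminf_add)
  also have "(\<Sum>i. ennreal (e * (1/2) ^ Suc i)) = ennreal e"
    using sums_mult[OF power_half_series, of e] e by (intro suminf_ennreal_eq) auto
  finally show "hausdorff_content \<rho> c s \<delta> (\<Union>i. A i) \<le> (\<Sum>i. hausdorff_content \<rho> c s \<delta> (A i)) + ennreal e" .
qed

lemma hausdorff_content_le_outer: "0 < \<delta> \<Longrightarrow> hausdorff_content \<rho> c s \<delta> A \<le> hausdorff_outer \<rho> c s A"
  unfolding hausdorff_outer_def by (intro SUP_upper) auto

lemma hausdorff_outer_le:
  "(\<And>\<delta>. 0 < \<delta> \<Longrightarrow> hausdorff_content \<rho> c s \<delta> A \<le> K) \<Longrightarrow> hausdorff_outer \<rho> c s A \<le> K"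
  unfolding hausdorff_outer_def by (intro SUP_least) auto

lemma hausdorff_outer_empty [simp]: "hausdorff_outer \<rho> c s {} = 0"
proof -
  have "hausdorff_outer \<rho> c s {} \<le> 0"
  proof (rule hausdorff_outer_le)
    fix \<delta> :: real
    show "hausdorff_content \<rho> c s \<delta> {} \<le> 0"
      using hausdorff_content_le[of "{}" "\<lambda>_. {}" \<rho> \<delta> c s] by simp
  qed
  then show ?thesis by simp
qed

lemma hausdorff_outer_mono: "A \<subseteq> B \<Longrightarrow> hausdorff_outer \<rho> c s A \<le> hausdorff_outer \<rho> c s B"
  by (meson hausdorff_outer_le hausdorff_content_le_outer hausdorff_content_mono order_trans)

lemma hausdorff_outer_UN_le:
  "hausdorff_outer \<rho> c s (\<Union>i. A i) \<le> (\<Sum>i. hausdorff_outer \<rho> c s (A i))"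
  by (intro hausdorff_outer_le order_trans[OF hausdorff_content_UN_le] suminf_le hausdorff_content_le_outer) auto

lemma outer_measure_space_hausdorff_outer: "outer_measure_space (Pow UNIV) (hausdorff_outer \<rho> c s)"
  by (auto simp: outer_measure_space_def positive_def increasing_def countably_subadditive_def
      intro: hausdorff_outer_mono hausdorff_outer_UN_le)

text \<open>For \<open>\<delta> < e\<close> a covering set of diameter at most \<open>\<delta>\<close> meets only one of the two sets, so
  a cover of the union splits into two disjoint families.\<close>

lemma hausdorff_outer_Un_separated:
  assumes "0 < e" and sep: "\<And>x y. x \<in> A \<Longrightarrow> y \<in> B \<Longrightarrow> ennreal e \<le> \<rho> x y"
  shows "hausdorff_outer \<rho> c s A + hausdorff_outer \<rho> c s B \<le> hausdorff_outer \<rho> c s (A \<union> B)"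
proof -
  have small: "hausdorff_content \<rho> c s \<delta> A + hausdorff_content \<rho> c s \<delta> B
      \<le> hausdorff_content \<rho> c s \<delta> (A \<union> B)" if "0 < \<delta>" "\<delta> < e" for \<delta>
  proof (rule hausdorff_content_ge)
    fix E :: "nat \<Rightarrow> 'a set" assume E: "A \<union> B \<subseteq> (\<Union>i. E i)" "\<And>i. diam_of \<rho> (E i) \<le> ennreal \<delta>"
    let ?w = "\<lambda>E. ennreal (c * enn2real (diam_of \<rho> E) powr s)"
    have "hausdorff_content \<rho> c s \<delta> A + hausdorff_content \<rho> c s \<delta> B
       \<le> (\<Sum>i. ?w (if E i \<inter> B = {} then E i else {})) + (\<Sum>i. ?w (if E i \<inter> B = {} then {} else E i))"
    proof (intro add_mono hausdorff_content_le)
      have "E i \<inter> A = {}" if meets_B: "E i \<inter> B \<noteq> {}" for i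
      proof (rule ccontr)
        assume "E i \<inter> A \<noteq> {}"
        then obtain x y where xy: "x \<in> A" "y \<in> B" "x \<in> E i" "y \<in> E i" using meets_B by blast
        then have "ennreal e \<le> ennreal \<delta>"
          using sep[of x y] diam_of_ge[of x "E i" y \<rho>] E(2)[of i] by (meson order_trans)
        then show False using \<open>0 < \<delta>\<close> \<open>\<delta> < e\<close> by (simp add: ennreal_le_iff)
      qed
      note disj = this
      show "A \<subseteq> (\<Union>i. if E i \<inter> B = {} then E i else {})"
      proof
        fix x assume "x \<in> A"
        then obtain i where "x \<in> E i" using E(1) by blast
        then show "x \<in> (\<Union>i. if E i \<inter> B = {} then E i else {})"
          using disj[of i] \<open>x \<in> A\<close> by (intro UN_I[of i]) auto
      qed
      show "B \<subseteq> (\<Union>i. if E i \<inter> B = {} then {} else E i)"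
      proof
        fix x assume "x \<in> B"
        then obtain i where "x \<in> E i" using E(1) by blast
        then show "x \<in> (\<Union>i. if E i \<inter> B = {} then {} else E i)"
          using \<open>x \<in> B\<close> by (intro UN_I[of i]) auto
      qed
    qed (simp_all add: E(2))
    also have "\<dots> = (\<Sum>i. ?w (if E i \<inter> B = {} then E i else {}) + ?w (if E i \<inter> B = {} then {} else E i))"
      by (simp add: suminf_add)
    also have "\<dots> = (\<Sum>i. ?w (E i))" by (intro suminf_cong) auto
    finally show "hausdorff_content \<rho> c s \<delta> A + hausdorff_content \<rho> c s \<delta> B \<le> (\<Sum>i. ?w (E i))" .
  qed
  have "hausdorff_outer \<rho> c s A + hausdorff_outer \<rho> c s B
     = (SUP \<delta>\<in>{0<..}. hausdorff_content \<rho> c s \<delta> A + hausdorff_content \<rho> c s \<delta> B)"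
    unfolding hausdorff_outer_def
  proof (rule SUP_add_directed_ennreal[symmetric])
    fix i j :: real assume "i \<in> {0<..}" "j \<in> {0<..}"
    then show "\<exists>k\<in>{0<..}. hausdorff_content \<rho> c s i A + hausdorff_content \<rho> c s j B
        \<le> hausdorff_content \<rho> c s k A + hausdorff_content \<rho> c s k B"
      by (intro bexI[of _ "min i j"] add_mono hausdorff_content_antimono) auto
  qed
  also have "\<dots> \<le> hausdorff_outer \<rho> c s (A \<union> B)"
  proof (intro SUP_least)
    fix \<delta> :: real assume "\<delta> \<in> {0<..}"
    then have d: "0 < min \<delta> (e/2)" "min \<delta> (e/2) < e" using \<open>0 < e\<close> by auto
    have "hausdorff_content \<rho> c s \<delta> A + hausdorff_content \<rho> c s \<delta> B
       \<le> hausdorff_content \<rho> c s (min \<delta> (e/2)) A + hausdorff_content \<rho> c s (min \<delta> (e/2)) B"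
      by (intro add_mono hausdorff_content_antimono) auto
    also have "\<dots> \<le> hausdorff_content \<rho> c s (min \<delta> (e/2)) (A \<union> B)" by (rule small[OF d])
    also have "\<dots> \<le> hausdorff_outer \<rho> c s (A \<union> B)" by (rule hausdorff_content_le_outer[OF d(1)])
    finally show "hausdorff_content \<rho> c s \<delta> A + hausdorff_content \<rho> c s \<delta> B \<le> hausdorff_outer \<rho> c s (A \<union> B)" .
  qed
  finally show ?thesis .
qed

text \<open>The hypothesis concerns points of \<open>A\<close> only, because a cover of \<open>A\<close> may be replaced by
  its traces on \<open>A\<close>. A comparison of two distances on a ball therefore compares
  their Hausdorff measures on the subsets of that ball.\<close>

lemma hausdorff_outer_lipschitz:
  assumes M: "0 < M" and "0 < s" "0 < c"
    and lip: "\<And>x y. x \<in> A \<Longrightarrow> y \<in> A \<Longrightarrow> \<rho>' x y \<le> ennreal M * \<rho> x y"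
  shows "hausdorff_outer \<rho>' c s A \<le> ennreal (M powr s) * hausdorff_outer \<rho> c s A"
proof (rule hausdorff_outer_le)
  fix \<delta> :: real assume "0 < \<delta>"
  have "hausdorff_content \<rho>' c s \<delta> A / ennreal (M powr s) \<le> hausdorff_content \<rho> c s (\<delta> / M) A"
  proof (rule hausdorff_content_ge)
    fix E :: "nat \<Rightarrow> 'a set" assume E: "A \<subseteq> (\<Union>i. E i)" "\<And>i. diam_of \<rho> (E i) \<le> ennreal (\<delta> / M)"
    have diam: "diam_of \<rho>' (E i \<inter> A) \<le> ennreal M * diam_of \<rho> (E i)" for i
      unfolding diam_of_def[of \<rho>']
    proof (intro SUP_least, clarify)
      fix x y assume "x \<in> E i" "y \<in> E i" "x \<in> A" "y \<in> A"
      then show "\<rho>' x y \<le> ennreal M * diam_of \<rho> (E i)"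
        by (intro order_trans[OF lip] mult_left_mono diam_of_ge) auto
    qed
    have "hausdorff_content \<rho>' c s \<delta> A \<le> (\<Sum>i. ennreal (c * enn2real (diam_of \<rho>' (E i \<inter> A)) powr s))"
    proof (rule hausdorff_content_le)
      show "A \<subseteq> (\<Union>i. E i \<inter> A)" using E(1) by blast
      fix i
      note diam[of i]
      also have "ennreal M * diam_of \<rho> (E i) \<le> ennreal M * ennreal (\<delta> / M)"
        using E(2) by (intro mult_left_mono) auto
      also have "\<dots> = ennreal \<delta>" using M \<open>0 < \<delta>\<close> by (simp add: ennreal_mult[symmetric])
      finally show "diam_of \<rho>' (E i \<inter> A) \<le> ennreal \<delta>" .
    qed
    also have "\<dots> \<le> (\<Sum>i. ennreal (M powr s) * ennreal (c * enn2real (diam_of \<rho> (E i)) powr s))"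
    proof (intro suminf_le allI summableI)
      fix i
      have fin: "diam_of \<rho> (E i) < top" using E(2)[of i] by (simp add: le_less_trans)
      have "enn2real (diam_of \<rho>' (E i \<inter> A)) \<le> enn2real (ennreal M * diam_of \<rho> (E i))"
        using fin by (intro enn2real_mono diam) (simp add: ennreal_mult_less_top)
      also have "\<dots> = M * enn2real (diam_of \<rho> (E i))" using M by (simp add: enn2real_mult)
      finally have "enn2real (diam_of \<rho>' (E i \<inter> A)) powr s \<le> (M * enn2real (diam_of \<rho> (E i))) powr s"
        using \<open>0 < s\<close> by (intro powr_mono2) auto
      also have "\<dots> = M powr s * enn2real (diam_of \<rho> (E i)) powr s" using M by (simp add: powr_mult)
      finally show "ennreal (c * enn2real (diam_of \<rho>' (E i \<inter> A)) powr s)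
          \<le> ennreal (M powr s) * ennreal (c * enn2real (diam_of \<rho> (E i)) powr s)"
        using \<open>0 < c\<close> by (simp add: ennreal_mult[symmetric] ennreal_leI mult.left_commute)
    qed
    also have "\<dots> = ennreal (M powr s) * (\<Sum>i. ennreal (c * enn2real (diam_of \<rho> (E i)) powr s))"
      by simp
    finally show "hausdorff_content \<rho>' c s \<delta> A / ennreal (M powr s)
        \<le> (\<Sum>i. ennreal (c * enn2real (diam_of \<rho> (E i)) powr s))"
      using M by (intro divide_le_posI_ennreal) (auto simp: mult.commute)
  qed
  then have "ennreal (M powr s) * (hausdorff_content \<rho>' c s \<delta> A / ennreal (M powr s))
      \<le> ennreal (M powr s) * hausdorff_content \<rho> c s (\<delta> / M) A" by (intro mult_left_mono) auto
  then have "hausdorff_content \<rho>' c s \<delta> A \<le> ennreal (M powr s) * hausdorff_content \<rho> c s (\<delta> / M) A"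
    using M by (simp add: ennreal_times_divide mult.commute[of "ennreal (M powr s)" "hausdorff_content \<rho>' c s \<delta> A"]
        mult_divide_eq_ennreal)
  also have "\<dots> \<le> ennreal (M powr s) * hausdorff_outer \<rho> c s A"
    using M \<open>0 < \<delta>\<close> by (intro mult_left_mono hausdorff_content_le_outer) auto
  finally show "hausdorff_content \<rho>' c s \<delta> A \<le> ennreal (M powr s) * hausdorff_outer \<rho> c s A" .
qed

section \<open>Measurability of Borel sets\<close>

lemma outer_measure_spaceD:
  assumes "outer_measure_space (Pow UNIV) h"
  shows "h {} = 0" "A \<subseteq> B \<Longrightarrow> h A \<le> h B" "h (\<Union>i. F i) \<le> (\<Sum>i. h (F i))"
    "h (A \<union> B) \<le> h A + h B"
proof -
  have p: "positive (Pow UNIV) h" and i: "increasing (Pow UNIV) h" and c: "countably_subadditive (Pow UNIV) h"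
    using assms by (auto simp: outer_measure_space_def)
  interpret ring_of_sets UNIV "Pow UNIV :: 'a set set"
    using algebra_Pow algebra.axioms(1) by blast
  show "h {} = 0" using p by (simp add: positive_def)
  show mono: "A \<subseteq> B \<Longrightarrow> h A \<le> h B" for A B using i by (auto simp: increasing_def)
  have "h (A \<union> B) = h (A \<union> (B - A))" by simp
  also have "\<dots> \<le> h A + h (B - A)"
    by (rule subadditiveD[OF countably_subadditive_subadditive[OF p c]]) auto
  also have "\<dots> \<le> h A + h B" by (intro add_left_mono mono) auto
  finally show Un: "h (A \<union> B) \<le> h A + h B" .
  show "h (\<Union>i. F i) \<le> (\<Sum>i. h (F i))"
  proof -
    have "h (\<Union>i. disjointed F i) \<le> (\<Sum>i. h (disjointed F i))"
      using c disjoint_family_disjointed[of F] by (auto simp: countably_subadditive_def)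
    also have "\<dots> \<le> (\<Sum>i. h (F i))" by (intro suminf_le mono disjointed_subset) auto
    finally show ?thesis by (simp add: UN_disjointed_eq)
  qed
qed

text \<open>For real series this is \<open>suminf_exist_split2\<close>; finiteness of the sum makes all terms real.\<close>

lemma suminf_ennreal_tail_tendsto_0:
  fixes f :: "nat \<Rightarrow> ennreal"
  assumes "(\<Sum>i. f i) < top"
  shows "(\<lambda>n. \<Sum>i. f (i + n)) \<longlonglongrightarrow> 0"
proof -
  define g where "g i = enn2real (f i)" for i
  have f: "f = (\<lambda>i. ennreal (g i))" using ennreal_suminf_lessD[OF assms] by (simp add: g_def fun_eq_iff)
  have nonneg: "0 \<le> g i" for i by (simp add: g_def)
  have sm: "summable g" using assms nonneg by (intro summable_suminf_not_top) (auto simp: f)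
  have "(\<lambda>n. ennreal (\<Sum>i. g (i + n))) \<longlonglongrightarrow> ennreal 0"
    by (intro tendsto_ennrealI suminf_exist_split2 sm)
  moreover have "(\<Sum>i. f (i + n)) = ennreal (\<Sum>i. g (i + n))" for n
    unfolding f by (rule suminf_ennreal2[OF nonneg]) (use sm in \<open>simp add: summable_iff_shift\<close>)
  ultimately show ?thesis by simp
qed

text \<open>The core of Caratheodory's criterion for metric outer measures. For a test set \<open>A\<close>, the
  separation hypothesis bounds \<open>h A\<close> below by the sum of \<open>h (A \<inter> U n)\<close> and the measure of
  the part of \<open>A\<close> outside the union. What is left of \<open>A\<close> is covered by the later rings
  \<open>U (k + 1) - U k\<close>. Rings whose indices differ by at least two are separated, so the
  measures of their intersections with \<open>A\<close> form a convergent series if \<open>h A\<close> is finite, and the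
  error tends to \<open>0\<close>.\<close>

lemma exhaustion_in_lambda_system:
  fixes h :: "'a set \<Rightarrow> ennreal"
  assumes oms: "outer_measure_space (Pow UNIV) h" and incr: "\<And>n. U n \<subseteq> U (Suc n)"
    and sep: "\<And>n S T. S \<subseteq> U n \<Longrightarrow> T \<inter> U (Suc n) = {} \<Longrightarrow> h S + h T \<le> h (S \<union> T)"
  shows "(\<Union>n. U n) \<in> lambda_system UNIV (Pow UNIV) h"
proof -
  note h = outer_measure_spaceD[OF oms]
  have U_mono: "U i \<subseteq> U j" if "i \<le> j" for i j using lift_Suc_mono_le[of U, OF incr that] .
  let ?U = "\<Union>n. U n"
  have "h (A \<inter> ?U) + h (A - ?U) \<le> h A" for A
  proof (cases "h A = top")
    case False
    define V where "V n = A \<inter> U n" for n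
    define R where "R n = V (Suc n) - V n" for n
    have V_le: "h (V n) \<le> h A" for n by (intro h(2)) (auto simp: V_def)
    \<comment> \<open>Even and odd rings are summed at once: \<open>V n\<close> is separated from the ring
      \<open>R (n + 1)\<close>, and both lie in \<open>V (n + 2)\<close>.\<close>
    have rings: "(\<Sum>i<n. h (R (Suc i))) \<le> h (V (Suc n)) + h (V n)" for n
    proof (induction n)
      case (Suc n)
      have "h (V n) + h (R (Suc n)) \<le> h (V n \<union> R (Suc n))"
        by (rule sep[of _ n]) (auto simp: V_def R_def)
      also have "\<dots> \<le> h (V (Suc (Suc n)))"
        by (intro h(2)) (use U_mono[of n "Suc (Suc n)"] in \<open>auto simp: V_def R_def\<close>)
      finally have step: "h (V n) + h (R (Suc n)) \<le> h (V (Suc (Suc n)))" .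
      have "(\<Sum>i<Suc n. h (R (Suc i))) \<le> h (V (Suc n)) + (h (V n) + h (R (Suc n)))"
        using Suc by (simp add: add.assoc[symmetric] add_right_mono)
      also have "\<dots> \<le> h (V (Suc n)) + h (V (Suc (Suc n)))" by (intro add_left_mono step)
      finally show ?case by (simp add: add.commute)
    qed simp
    have "(\<Sum>i. h (R (Suc i))) \<le> h A + h A"
      using order_trans[OF rings add_mono[OF V_le V_le]] by (intro suminf_le_const) auto
    then have "(\<Sum>i. h (R (Suc i))) < top"
      using False by (metis ennreal_add_eq_top less_top top.extremum_unique)
    from suminf_ennreal_tail_tendsto_0[OF this]
    have tail0: "(\<lambda>n. \<Sum>i. h (R (Suc (i + n)))) \<longlonglongrightarrow> 0" .
    show ?thesis
    proof (rule LIMSEQ_le_const[OF tendsto_add[OF tendsto_const tail0, of "h A", simplified]], intro exI allI impI)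
      fix n :: nat
      have "A \<inter> ?U \<subseteq> V (Suc n) \<union> (\<Union>i. R (Suc (i + n)))"
      proof clarify
        fix x k assume x: "x \<in> A" "x \<in> U k" "x \<notin> (\<Union>i. R (Suc (i + n)))"
        define k0 where "k0 = (LEAST k. x \<in> U k)"
        have k0: "x \<in> U k0" "\<And>k. k < k0 \<Longrightarrow> x \<notin> U k"
          using x(2) by (auto simp: k0_def intro: LeastI dest: not_less_Least)
        show "x \<in> V (Suc n)"
        proof (rule ccontr)
          assume "x \<notin> V (Suc n)"
          then have "Suc n < k0" using U_mono[of k0 "Suc n"] k0(1) x(1) by (force simp: V_def)
          then obtain i where "k0 = Suc (Suc (i + n))" by (metis add.commute add_Suc_right less_iff_Suc_add add_Suc)
          then have "x \<in> R (Suc (i + n))" using k0 x(1) by (simp add: R_def V_def)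
          then show False using x(3) by blast
        qed
      qed
      then have "h (A \<inter> ?U) \<le> h (V (Suc n) \<union> (\<Union>i. R (Suc (i + n))))" by (rule h(2))
      also have "\<dots> \<le> h (V (Suc n)) + (\<Sum>i. h (R (Suc (i + n))))"
        by (intro order_trans[OF h(4)] add_left_mono h(3))
      finally have "h (A \<inter> ?U) + h (A - ?U) \<le> h (V (Suc n)) + h (A - ?U) + (\<Sum>i. h (R (Suc (i + n))))"
        by (simp add: add.assoc add.commute[of "h (A - ?U)"] add.left_commute add_mono)
      also have "h (V (Suc n)) + h (A - ?U) \<le> h (V (Suc n) \<union> (A - ?U))"
        by (rule sep[of _ "Suc n"]) (auto simp: V_def)
      also have "\<dots> \<le> h A" by (intro h(2)) (auto simp: V_def)
      finally show "h (A \<inter> ?U) + h (A - ?U) \<le> h A + (\<Sum>i. h (R (Suc (i + n))))"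
        by (simp add: add_right_mono)
    qed
  qed simp
  moreover have "h A \<le> h (A \<inter> ?U) + h (A - ?U)" for A
    using h(4)[of "A \<inter> ?U" "A - ?U"] by (simp add: Int_Diff_Un)
  ultimately show ?thesis
    unfolding algebra.lambda_system_eq[OF algebra_Pow] by (auto intro!: antisym simp: Int_commute)
qed

text \<open>The hypothesis on \<open>\<rho>\<close> says that, locally uniformly in \<open>y\<close>, points far from \<open>y\<close> for
  \<open>dist\<close> are far from \<open>y\<close> for \<open>\<rho>\<close>. An open set \<open>W\<close> inside one of the given balls is
  exhausted by its points of distance at least \<open>1 / (n + 1)\<close> from the complement, and
  the exhaustion is separated as \<open>exhaustion_in_lambda_system\<close> requires. The countable
  ball cover extends this to all open sets.\<close>

lemma borel_subset_lambda_system_hausdorff_outer: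
  fixes \<rho> :: "'a::metric_space \<Rightarrow> 'a \<Rightarrow> ennreal"
  assumes separable: "separable_space (euclidean :: 'a topology)" and r: "\<And>x. 0 < r x"
    and far: "\<And>x e. 0 < e \<Longrightarrow> \<exists>e'>0. \<forall>y\<in>ball x (r x). \<forall>z. e \<le> dist y z \<longrightarrow> ennreal e' \<le> \<rho> y z"
  shows "sets borel \<subseteq> lambda_system UNIV (Pow UNIV) (hausdorff_outer \<rho> c s)"
proof -
  let ?L = "lambda_system UNIV (Pow UNIV) (hausdorff_outer \<rho> c s)"
  have "measure_space UNIV ?L (hausdorff_outer \<rho> c s)"
    by (rule sigma_algebra.caratheodory_lemma[OF sigma_algebra_Pow outer_measure_space_hausdorff_outer])
  then interpret L: sigma_algebra UNIV ?L by (simp add: measure_space_def)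
  have local: "W \<in> ?L" if W: "open W" "W \<subseteq> ball x (r x)" for W x
  proof -
    define U where "U n = {y. ball y (1 / Suc n) \<subseteq> W}" for n
    have U_le: "U n \<subseteq> W" for n unfolding U_def by (auto simp: subset_iff)
    have "(\<Union>n. U n) \<in> ?L"
    proof (rule exhaustion_in_lambda_system[OF outer_measure_space_hausdorff_outer])
      show "U n \<subseteq> U (Suc n)" for n
      proof -
        have "ball y (1 / Suc (Suc n)) \<subseteq> ball y (1 / Suc n)" for y :: 'a
          by (intro subset_ball) (simp add: frac_le)
        then show ?thesis unfolding U_def by blast
      qed
      fix n S T assume S: "S \<subseteq> U n" and T: "T \<inter> U (Suc n) = {}"
      define e :: real where "e = 1 / Suc n - 1 / Suc (Suc n)"
      have "0 < e" unfolding e_def by (simp add: frac_less2)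
      then obtain e' where e': "0 < e'" "\<And>y z. y \<in> ball x (r x) \<Longrightarrow> e \<le> dist y z \<Longrightarrow> ennreal e' \<le> \<rho> y z"
        using far by metis
      show "hausdorff_outer \<rho> c s S + hausdorff_outer \<rho> c s T \<le> hausdorff_outer \<rho> c s (S \<union> T)"
      proof (rule hausdorff_outer_Un_separated[OF e'(1)], rule e'(2))
        fix y z assume y: "y \<in> S" and z: "z \<in> T"
        show "y \<in> ball x (r x)" using y S U_le W by blast
        have "z \<notin> U (Suc n)" using z T by blast
        then obtain w where w: "dist z w < 1 / Suc (Suc n)" "w \<notin> W" unfolding U_def by (auto simp: subset_iff)
        have "1 / Suc n \<le> dist y w" using w(2) y S unfolding U_def by (force simp: not_less[symmetric])
        then show "e \<le> dist y z" using w(1) dist_triangle[of y w z] unfolding e_def by linarith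
      qed
    qed
    also have "(\<Union>n. U n) = W"
    proof (intro equalityI subsetI)
      fix y assume "y \<in> W"
      then obtain d where d: "0 < d" "ball y d \<subseteq> W" using W(1) open_contains_ball by blast
      then obtain n where "inverse (real (Suc n)) < d" using reals_Archimedean by blast
      then have "ball y (1 / Suc n) \<subseteq> W"
        using d(2) subset_ball[of "1 / Suc n" d y] by (auto simp: inverse_eq_divide)
      then show "y \<in> (\<Union>n. U n)" unfolding U_def by blast
    qed (use U_le in blast)
    finally show ?thesis .
  qed
  obtain f :: "nat \<Rightarrow> 'a" where f: "(\<Union>n. ball (f n) (r (f n))) = UNIV"
    by (rule countable_ball_cover[OF separable r])
  have "W \<in> ?L" if "open W" for W
  proof -
    have "(\<Union>n. W \<inter> ball (f n) (r (f n))) \<in> ?L"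
      using that by (intro L.countable_UN image_subsetI local) auto
    also have "(\<Union>n. W \<inter> ball (f n) (r (f n))) = W" using f by blast
    finally show ?thesis .
  qed
  then show ?thesis unfolding sets_borel
    using L.sigma_sets_subset[of "{S. open S}"] by (auto simp: borel_def)
qed

lemma emeasure_hausdorff_measure:
  fixes \<rho> :: "'a::metric_space \<Rightarrow> 'a \<Rightarrow> ennreal"
  assumes "separable_space (euclidean :: 'a topology)" "\<And>x. 0 < r x"
    "\<And>x e. 0 < e \<Longrightarrow> \<exists>e'>0. \<forall>y\<in>ball x (r x). \<forall>z. e \<le> dist y z \<longrightarrow> ennreal e' \<le> \<rho> y z"
    and A: "A \<in> sets borel"
  shows "emeasure (hausdorff_measure \<rho> c s) A = hausdorff_outer \<rho> c s A"
proof -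
  have sa: "sigma_algebra UNIV (sets (borel :: 'a measure))"
    using sets.sigma_algebra_axioms[of "borel :: 'a measure"] by (simp only: space_borel)
  have "measure_space UNIV (sets borel) (hausdorff_outer \<rho> c s)"
    by (rule measure_down[OF sigma_algebra.caratheodory_lemma[OF sigma_algebra_Pow
          outer_measure_space_hausdorff_outer] sa borel_subset_lambda_system_hausdorff_outer[OF assms(1-3)]])
  then show ?thesis
    unfolding hausdorff_measure_def using A
    by (intro emeasure_measure_of_sigma) (auto simp: measure_space_def)
qed

lemma sets_hausdorff_measure [simp]: "sets (hausdorff_measure \<rho> c s) = sets borel"
  unfolding hausdorff_measure_def
  using sets.sets_measure_of_eq[of borel] by (simp only: space_borel)

section \<open>The conformal Hausdorff measure as a density\<close>

text \<open>A bound between two measures that holds on all subsets of each member of a countable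
  measurable cover is global: cut a set into disjoint pieces subordinate to the cover.\<close>

lemma emeasure_le_cmult_of_countable_cover:
  assumes sets_eq: "sets M = sets N" and U: "\<And>i :: nat. U i \<in> sets N" "space N \<subseteq> (\<Union>i. U i)"
    and le: "\<And>i A. A \<in> sets N \<Longrightarrow> A \<subseteq> U i \<Longrightarrow> emeasure M A \<le> K * emeasure N A"
    and A: "A \<in> sets N"
  shows "emeasure M A \<le> K * emeasure N A"
proof -
  let ?D = "\<lambda>i. A \<inter> disjointed U i"
  have D: "range ?D \<subseteq> sets N" using sets.range_disjointed_sets[of U N] U(1) A by blast
  have disj: "disjoint_family ?D"
    using disjoint_family_disjointed[of U] by (auto simp: disjoint_family_on_def)
  have UN: "(\<Union>i. ?D i) = A"
  proof -
    have "(\<Union>i. ?D i) = A \<inter> (\<Union>i. U i)"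
      unfolding UN_disjointed_eq[of U, symmetric] by (rule Int_UN_distrib[symmetric])
    also have "\<dots> = A" using U(2) sets.sets_into_space[OF A] by (intro Int_absorb2) (rule order_trans)
    finally show ?thesis .
  qed
  have "emeasure M A = (\<Sum>i. emeasure M (?D i))"
    using suminf_emeasure[of ?D M] D disj by (simp only: sets_eq UN)
  also have "\<dots> \<le> (\<Sum>i. K * emeasure N (?D i))"
    using D disjointed_subset[of U] by (intro suminf_le le) auto
  also have "\<dots> = K * emeasure N A"
    using suminf_emeasure[of ?D N] D disj by (simp only: UN ennreal_suminf_cmult)
  finally show ?thesis .
qed

lemma ennreal_le_of_le_mult_gt_1:
  fixes a b :: ennreal
  assumes le: "\<And>K::real. 1 < K \<Longrightarrow> a \<le> ennreal K * b"
  shows "a \<le> b"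
proof (cases b)
  case (real b')
  have "a \<le> ennreal 2 * b" by (rule le) simp
  also have "\<dots> < top" using real by (simp add: ennreal_mult_less_top)
  finally have "a < top" .
  then obtain a' where a': "0 \<le> a'" "a = ennreal a'" by (cases a) auto
  have "a' \<le> b'"
  proof (rule field_le_mult_one_interval)
    fix z :: real assume z: "0 < z" "z < 1"
    have "ennreal (1 / z * b') = ennreal (1 / z) * ennreal b'"
      using z real by (intro ennreal_mult) auto
    then have "ennreal a' \<le> ennreal (1 / z * b')" using le[of "1 / z"] z real a' by simp
    then show "z * a' \<le> b'" using z real by (simp add: field_simps ennreal_le_iff)
  qed
  then show ?thesis using real a' by (simp add: ennreal_leI)
qed simp

lemma emeasure_hausdorff_measure_dist:
  assumes "separable_space (euclidean :: 'a::metric_space topology)" "A \<in> sets borel"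
  shows "emeasure (hausdorff_measure (\<lambda>x y :: 'a. ennreal (dist x y)) c s) A
    = hausdorff_outer (\<lambda>x y. ennreal (dist x y)) c s A"
  by (rule emeasure_hausdorff_measure[where r = "\<lambda>_. 1"]) (use assms in \<open>auto intro!: exI ennreal_leI\<close>)

lemma continuous_locally_comparable:
  fixes \<Omega> :: "'a::metric_space \<Rightarrow> real"
  assumes "continuous_on UNIV \<Omega>" "0 < \<Omega> x" "1 < q"
  shows "\<exists>r>0. \<forall>w\<in>ball x (4 * r). \<Omega> x / q \<le> \<Omega> w \<and> \<Omega> w \<le> q * \<Omega> x"
proof -
  have "open {w. \<Omega> x / q < \<Omega> w \<and> \<Omega> w < q * \<Omega> x}"
    by (intro open_Collect_conj open_Collect_less continuous_on_const assms(1))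
  moreover have "x \<in> {w. \<Omega> x / q < \<Omega> w \<and> \<Omega> w < q * \<Omega> x}" using assms by (simp add: divide_less_eq)
  ultimately obtain d where d: "0 < d" "ball x d \<subseteq> {w. \<Omega> x / q < \<Omega> w \<and> \<Omega> w < q * \<Omega> x}"
    by (rule openE)
  have "\<Omega> x / q \<le> \<Omega> w \<and> \<Omega> w \<le> q * \<Omega> x" if w: "w \<in> ball x (4 * (d / 4))" for w
  proof -
    have "w \<in> ball x d" using w by simp
    from subsetD[OF d(2) this] show ?thesis unfolding mem_Collect_eq by (metis less_imp_le)
  qed
  then show ?thesis using d(1) by (intro exI[of _ "d / 4"] conjI ballI) simp_all
qed

text \<open>The lower estimate for \<^term>\<open>conformal_dist \<Omega>\<close>, on balls where \<open>\<Omega>\<close> varies at most by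
  the factor \<open>2\<close> from its value at the center, is the separation hypothesis of
  \<open>emeasure_hausdorff_measure\<close>.\<close>

lemma emeasure_hausdorff_measure_conformal_dist:
  fixes \<Omega> :: "'a::metric_space \<Rightarrow> real"
  assumes sep: "separable_space (euclidean :: 'a topology)" and cont: "continuous_on UNIV \<Omega>"
    and pos: "\<And>x. 0 < \<Omega> x" and A: "A \<in> sets borel"
  shows "emeasure (hausdorff_measure (conformal_dist \<Omega>) c s) A = hausdorff_outer (conformal_dist \<Omega>) c s A"
proof -
  have "\<forall>x. \<exists>r>0. \<forall>w\<in>ball x (4 * r). \<Omega> x / 2 \<le> \<Omega> w \<and> \<Omega> w \<le> 2 * \<Omega> x"
    by (intro allI continuous_locally_comparable assms) simp
  then obtain r where r: "\<And>x. 0 < r x" "\<And>x w. w \<in> ball x (4 * r x) \<Longrightarrow> \<Omega> x / 2 \<le> \<Omega> w" by metis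
  show ?thesis
  proof (rule emeasure_hausdorff_measure[OF sep r(1) _ A])
    fix x :: 'a and e :: real assume e: "0 < e"
    show "\<exists>e'>0. \<forall>y\<in>ball x (r x). \<forall>z. e \<le> dist y z \<longrightarrow> ennreal e' \<le> conformal_dist \<Omega> y z"
    proof (intro exI conjI ballI allI impI)
      show "0 < \<Omega> x / 2 * min e (2 * r x)" using e r(1) pos[of x] by simp
      fix y z assume y: "y \<in> ball x (r x)" and "e \<le> dist y z"
      then have "ennreal (\<Omega> x / 2 * min e (2 * r x)) \<le> ennreal (\<Omega> x / 2 * min (dist y z) (2 * r x))"
        using pos[of x] by (intro ennreal_leI mult_left_mono) auto
      also have "\<dots> \<le> conformal_dist \<Omega> y z"
        by (rule conformal_dist_ge_local[OF r(2) _ r(1) y]) (use pos[of x] in auto)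
      finally show "ennreal (\<Omega> x / 2 * min e (2 * r x)) \<le> conformal_dist \<Omega> y z" .
    qed
  qed
qed

text \<open>On \<open>ball x r\<close> the two distances are comparable with the constants \<open>m\<close> and \<open>M\<close>, so
  \<open>hausdorff_outer_lipschitz\<close> applies in both directions.\<close>

lemma hausdorff_outer_conformal_dist_local:
  fixes x :: "'a::metric_space"
  assumes len: "length_space TYPE('a)" and pos: "\<And>w. 0 < \<Omega> w" and r: "0 < r" and m: "0 < m"
    and \<Omega>: "\<And>w. w \<in> ball x (4 * r) \<Longrightarrow> m \<le> \<Omega> w \<and> \<Omega> w \<le> M"
    and A: "A \<subseteq> ball x r" and s: "0 < s" and c: "0 < c"
  shows "hausdorff_outer (conformal_dist \<Omega>) c s A
      \<le> ennreal (M powr s) * hausdorff_outer (\<lambda>x y. ennreal (dist x y)) c s A" (is "?h' \<le> _ * ?h")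
    and "ennreal (m powr s) * hausdorff_outer (\<lambda>x y. ennreal (dist x y)) c s A
      \<le> hausdorff_outer (conformal_dist \<Omega>) c s A"
proof -
  have "x \<in> ball x (4 * r)" using r by simp
  from \<Omega>[OF this] m have "0 < M" by linarith
  show "?h' \<le> ennreal (M powr s) * ?h"
  proof (rule hausdorff_outer_lipschitz[OF \<open>0 < M\<close> s c])
    fix y z assume "y \<in> A" "z \<in> A"
    then have "conformal_dist \<Omega> y z \<le> ennreal (M * dist y z)"
      using A \<Omega> by (intro conformal_dist_le_local[OF len less_imp_le[OF pos]]) auto
    then show "conformal_dist \<Omega> y z \<le> ennreal M * ennreal (dist y z)"
      using \<open>0 < M\<close> by (simp add: ennreal_mult)
  qed
  have "?h \<le> ennreal ((1 / m) powr s) * ?h'"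
  proof (rule hausdorff_outer_lipschitz[OF _ s c])
    fix y z assume "y \<in> A" "z \<in> A"
    then have yz: "y \<in> ball x r" "z \<in> ball x r" using A by auto
    then have "dist y z \<le> 2 * r" using dist_triangle[of y z x] by (simp add: dist_commute)
    then have "ennreal (m * dist y z) \<le> conformal_dist \<Omega> y z"
      using conformal_dist_ge_local[of x r m \<Omega> y z] \<Omega> m r yz by (simp add: min_absorb1)
    then have "ennreal (1 / m) * ennreal (m * dist y z) \<le> ennreal (1 / m) * conformal_dist \<Omega> y z"
      by (intro mult_left_mono) auto
    then show "ennreal (dist y z) \<le> ennreal (1 / m) * conformal_dist \<Omega> y z"
      using m by (simp add: ennreal_mult[symmetric])
  qed (use m in auto)
  then have "ennreal (m powr s) * ?h \<le> ennreal (m powr s) * (ennreal ((1 / m) powr s) * ?h')"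
    by (intro mult_left_mono) auto
  also have "\<dots> = ?h'"
    using m by (simp add: mult.assoc[symmetric] ennreal_mult[symmetric] powr_mult[symmetric])
  finally show "ennreal (m powr s) * ?h \<le> ?h'" .
qed

text \<open>On a ball where \<open>\<Omega>\<close> lies between \<open>m\<close> and \<open>M\<close>, both measures lie between
  \<open>m powr s\<close> and \<open>M powr s\<close> times the Hausdorff measure of \<open>dist\<close>. Given \<open>K > 1\<close>,
  small balls satisfy \<open>M powr s = K * m powr s\<close>, so the two measures agree
  up to the factor \<open>K\<close> on subsets of these balls, hence on all Borel sets, and \<open>K\<close> may
  tend to \<open>1\<close>.\<close>

lemma hausdorff_measure_conformal_dist_eq_density:
  fixes \<Omega> :: "'a::metric_space \<Rightarrow> real"
  assumes sep: "separable_space (euclidean :: 'a topology)" and len: "length_space TYPE('a)"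
    and cont: "continuous_on UNIV \<Omega>" and pos: "\<And>x. 0 < \<Omega> x" and s: "0 < s" and c: "0 < c"
  shows "hausdorff_measure (conformal_dist \<Omega>) c s =
    density (hausdorff_measure (\<lambda>x y. ennreal (dist x y)) c s) (\<lambda>x. ennreal (\<Omega> x powr s))"
    (is "?\<nu> = density ?\<mu> ?f")
proof (rule measure_eqI)
  have "\<Omega> \<in> borel_measurable borel" using cont by (rule borel_measurable_continuous_onI)
  then have f: "?f \<in> borel_measurable ?\<mu>"
    by (subst measurable_cong_sets[OF sets_hausdorff_measure refl]) measurable
  have dens: "emeasure (density ?\<mu> ?f) A = (\<integral>\<^sup>+x. ?f x * indicator A x \<partial>?\<mu>)" if "A \<in> sets borel" for A
    using f that by (simp add: emeasure_density)
  fix A assume "A \<in> sets ?\<nu>"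
  then have A: "A \<in> sets borel" by simp
  have both: "emeasure ?\<nu> A \<le> ennreal K * emeasure (density ?\<mu> ?f) A \<and>
      emeasure (density ?\<mu> ?f) A \<le> ennreal K * emeasure ?\<nu> A" if K: "1 < K" for K
  proof -
    \<comment> \<open>The bounds \<open>\<Omega> x / q\<close> and \<open>q * \<Omega> x\<close> have ratio \<open>q\<^sup>2\<close>, whose power \<open>s\<close> is \<open>K\<close>.\<close>
    define q where "q = K powr (1 / (2 * s))"
    have q: "1 < q" using K s by (simp add: q_def gr_one_powr)
    have qK: "(q * y) powr s = K * (y / q) powr s" if "0 < y" for y
    proof -
      have "q powr s * q powr s = K" using K s by (simp add: q_def powr_powr powr_add[symmetric])
      then show ?thesis using that q by (simp add: powr_mult powr_divide field_simps)
    qed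
    have "\<forall>x. \<exists>r>0. \<forall>w\<in>ball x (4 * r). \<Omega> x / q \<le> \<Omega> w \<and> \<Omega> w \<le> q * \<Omega> x"
      by (intro allI continuous_locally_comparable assms q)
    then obtain r where r: "\<And>x. 0 < r x"
      "\<And>x w. w \<in> ball x (4 * r x) \<Longrightarrow> \<Omega> x / q \<le> \<Omega> w \<and> \<Omega> w \<le> q * \<Omega> x" by metis
    obtain g :: "nat \<Rightarrow> 'a" where g: "(\<Union>n. ball (g n) (r (g n))) = UNIV"
      by (rule countable_ball_cover[OF sep r(1)])
    have local: "emeasure ?\<nu> B \<le> ennreal K * emeasure (density ?\<mu> ?f) B \<and>
        emeasure (density ?\<mu> ?f) B \<le> ennreal K * emeasure ?\<nu> B"
      if B: "B \<in> sets borel" "B \<subseteq> ball x (r x)" for B x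
    proof -
      let ?m = "\<Omega> x / q" and ?M = "q * \<Omega> x"
      have m: "0 < ?m" using pos q by simp
      have MK: "ennreal (?M powr s) = ennreal K * ennreal (?m powr s)"
        using qK[OF pos] K by (simp add: ennreal_mult)
      have \<nu>_le: "emeasure ?\<nu> B \<le> ennreal (?M powr s) * emeasure ?\<mu> B"
        and \<nu>_ge: "ennreal (?m powr s) * emeasure ?\<mu> B \<le> emeasure ?\<nu> B"
        using hausdorff_outer_conformal_dist_local[OF len pos r(1) m r(2) B(2) s c]
        by (simp_all add: emeasure_hausdorff_measure_dist[OF sep B(1)]
              emeasure_hausdorff_measure_conformal_dist[OF sep cont pos B(1)])
      have bounds: "?m powr s \<le> \<Omega> w powr s" "\<Omega> w powr s \<le> ?M powr s" if "w \<in> B" for w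
      proof -
        have "w \<in> ball x (4 * r x)" using subsetD[OF B(2) that] r(1)[of x] by simp
        from r(2)[OF this] show "?m powr s \<le> \<Omega> w powr s" "\<Omega> w powr s \<le> ?M powr s"
          using m pos[of w] s by (auto intro!: powr_mono2)
      qed
      have "(\<integral>\<^sup>+x. ?f x * indicator B x \<partial>?\<mu>) \<le> (\<integral>\<^sup>+x. ennreal (?M powr s) * indicator B x \<partial>?\<mu>)"
        by (intro nn_integral_mono) (auto simp: indicator_def intro!: ennreal_leI bounds)
      then have d_le: "emeasure (density ?\<mu> ?f) B \<le> ennreal (?M powr s) * emeasure ?\<mu> B"
        using B by (simp add: dens nn_integral_cmult_indicator)
      have "(\<integral>\<^sup>+x. ennreal (?m powr s) * indicator B x \<partial>?\<mu>) \<le> (\<integral>\<^sup>+x. ?f x * indicator B x \<partial>?\<mu>)"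
        by (intro nn_integral_mono) (auto simp: indicator_def intro!: ennreal_leI bounds)
      then have d_ge: "ennreal (?m powr s) * emeasure ?\<mu> B \<le> emeasure (density ?\<mu> ?f) B"
        using B by (simp add: dens nn_integral_cmult_indicator)
      show ?thesis
        using \<nu>_le d_le mult_left_mono[OF \<nu>_ge, of "ennreal K"] mult_left_mono[OF d_ge, of "ennreal K"]
        unfolding MK mult.assoc by (meson order_trans zero_le)
    qed
    have "emeasure ?\<nu> A \<le> ennreal K * emeasure (density ?\<mu> ?f) A"
      by (rule emeasure_le_cmult_of_countable_cover[where U = "\<lambda>n. ball (g n) (r (g n))"])
         (use g local A in auto)
    moreover have "emeasure (density ?\<mu> ?f) A \<le> ennreal K * emeasure ?\<nu> A"
      by (rule emeasure_le_cmult_of_countable_cover[where U = "\<lambda>n. ball (g n) (r (g n))"])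
         (use g local A in auto)
    ultimately show ?thesis ..
  qed
  show "emeasure ?\<nu> A = emeasure (density ?\<mu> ?f) A"
  proof (rule antisym)
    show "emeasure ?\<nu> A \<le> emeasure (density ?\<mu> ?f) A"
      by (rule ennreal_le_of_le_mult_gt_1) (rule both[THEN conjunct1])
    show "emeasure (density ?\<mu> ?f) A \<le> emeasure ?\<nu> A"
      by (rule ennreal_le_of_le_mult_gt_1) (rule both[THEN conjunct2])
  qed
qed simp

theorem theorem5p21:
  fixes \<Omega> :: "'a::metric_space \<Rightarrow> real" and s c :: real
  assumes "separable_space (euclidean :: 'a topology)"
    and "length_space TYPE('a)"
    and "continuous_on UNIV \<Omega>"
    and "\<And>x. \<Omega> x > 0"
    and "s > 0"
    and "c > 0"
  defines "\<mu> \<equiv> hausdorff_measure (\<lambda>x y :: 'a. ennreal (dist x y)) c s"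
    and "\<nu> \<equiv> hausdorff_measure (conformal_dist \<Omega>) c s"
  shows "absolutely_continuous \<mu> \<nu> \<and> absolutely_continuous \<nu> \<mu> \<and>
         (emeasure \<mu> UNIV = 0 \<longleftrightarrow> emeasure \<nu> UNIV = 0) \<and>
         (sigma_finite_measure \<mu> \<longleftrightarrow> sigma_finite_measure \<nu>) \<and>
         (sigma_finite_measure \<mu> \<longrightarrow>
           (\<forall>E\<in>sets borel. emeasure \<nu> E = (\<integral>\<^sup>+ x\<in>E. ennreal (\<Omega> x powr s) \<partial>\<mu>)))"
proof -
  let ?f = "\<lambda>x. ennreal (\<Omega> x powr s)" and ?g = "\<lambda>x. ennreal (\<Omega> x powr (- s))"
  have \<nu>: "\<nu> = density \<mu> ?f"
    unfolding \<mu>_def \<nu>_def by (rule hausdorff_measure_conformal_dist_eq_density) fact+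
  have [measurable_cong]: "sets \<mu> = sets borel" by (simp add: \<mu>_def)
  have [measurable]: "\<Omega> \<in> borel_measurable borel" using assms(3) by (rule borel_measurable_continuous_onI)
  have f: "?f \<in> borel_measurable \<mu>" and g: "?g \<in> borel_measurable \<mu>" by measurable
  have "density \<nu> ?g = density \<mu> (\<lambda>x. ?f x * ?g x)"
    unfolding \<nu> by (rule density_density_eq[OF f g])
  also have "(\<lambda>x. ?f x * ?g x) = (\<lambda>_. 1)"
    using assms(4) by (simp add: fun_eq_iff ennreal_mult[symmetric] powr_add[symmetric] less_imp_neq[symmetric])
  also have "density \<mu> (\<lambda>_. 1) = \<mu>" by (rule density_1)
  finally have \<mu>: "\<mu> = density \<nu> ?g" ..
  have g': "?g \<in> borel_measurable \<nu>" using g by (simp add: \<nu>)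
  have "absolutely_continuous \<mu> \<nu>" unfolding \<nu> by (rule absolutely_continuousI_density[OF f])
  moreover have "absolutely_continuous \<nu> \<mu>"
    using absolutely_continuousI_density[OF g'] by (simp flip: \<mu>)
  moreover have "UNIV \<in> null_sets \<mu> \<longleftrightarrow> emeasure \<mu> UNIV = 0" "UNIV \<in> null_sets \<nu> \<longleftrightarrow> emeasure \<nu> UNIV = 0"
    by (auto simp: null_sets_def \<mu>_def \<nu>_def)
  moreover have "sigma_finite_measure \<nu>" if "sigma_finite_measure \<mu>"
    unfolding \<nu> using sigma_finite_measure.sigma_finite_iff_density_finite[OF that f] by simp
  moreover have "sigma_finite_measure \<mu>" if "sigma_finite_measure \<nu>"
    by (subst \<mu>) (use sigma_finite_measure.sigma_finite_iff_density_finite[OF that g'] in simp)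
  moreover have "emeasure \<nu> E = (\<integral>\<^sup>+x\<in>E. ?f x \<partial>\<mu>)" if "E \<in> sets borel" for E
    unfolding \<nu> using that by (intro emeasure_density f) (simp add: \<mu>_def)
  ultimately show ?thesis
    unfolding absolutely_continuous_def by blast
qed

end
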